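(* Let $d\in\{2,3\}$ and let $A,B$ be complex $d\times d$ matrices. Then the following are equivalent: (1) $A$ and $B$ have identical pseudospectra, i.e. $\|(zI-A)^{-1}\|=\|(zI-B)^{-1}\|$ for all $z\in\mathbb{C}$; (2) $A$ and $B$ are polynomially isometric, i.e. $\|p(A)\|=\|p(B)\|$ for every polynomial $p$ with complex coefficients.
   Context: $\|\cdot\|$ denotes the spectral (operator) norm induced by the Euclidean norm on $\mathbb{C}^d$. By convention, $\|(zI-T)^{-1}\|=\infty$ when $z$ is an eigenvalue of $T$, so that identical pseudospectra in particular forces equal spectra. For a polynomial $p(z)=c_0+c_1z+\cdots+c_mz^m$, $p(T)=c_0I+c_1T+\cdots+c_mT^m$. *)

theory Defs
  imports "HOL-Analysis.Analysis" "HOL-Computational_Algebra.Polynomial"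
begin

definition spec_norm :: "complex^'n^'n \<Rightarrow> real" where
  "spec_norm M = onorm (\<lambda>x. M *v x)"

fun mat_pow :: "complex^'n^'n \<Rightarrow> nat \<Rightarrow> complex^'n^'n" where
  "mat_pow A 0 = mat 1"
| "mat_pow A (Suc k) = A ** mat_pow A k"

definition poly_mat :: "complex poly \<Rightarrow> complex^'n^'n \<Rightarrow> complex^'n^'n" where
  "poly_mat p A = (\<chi> i j. \<Sum>k\<le>degree p. coeff p k * (mat_pow A k) $ i $ j)"

definition resolvent_norm :: "complex^'n^'n \<Rightarrow> complex \<Rightarrow> ereal" where
  "resolvent_norm A z =
     (if invertible (mat z - A)
      then ereal (spec_norm (matrix_inv (mat z - A)))
      else \<infinity>)"

end

theory Submission
  imports Defs "HOL-Computational_Algebra.Field_as_Ring" "HOL-Computational_Algebra.Polynomial_Factorial"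
    "HOL-Computational_Algebra.Fundamental_Theorem_Algebra"
begin

text \<open>
  Write \<open>\<sigma>\<^sub>A(z) = \<parallel>(z - A)\<^sup>-\<^sup>1\<parallel>\<^sup>-\<^sup>1\<close>, which is \<open>0\<close> at the eigenvalues. If \<open>p(A) = 0\<close>, then
  \<open>(z - A) p\<^sub>z(A) = p(z)\<close> with \<open>p\<^sub>z(x) = (p(z) - p(x)) / (z - x)\<close>, hence \<open>\<sigma>\<^sub>A(z) \<parallel>p\<^sub>z(A)\<parallel> = |p(z)|\<close>. When \<open>p\<close> has
  least degree, \<open>p\<^sub>z(A) \<noteq> 0\<close>, so the norms of polynomials in \<open>A\<close> determine \<open>\<sigma>\<^sub>A\<close>, in every dimension.

  Conversely, comparing growth rates at the eigenvalues, matrices with the same pseudospectra have the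
  same annihilating polynomials. If one of these has degree two, the \<open>\<parallel>p\<^sub>z(A)\<parallel>\<close> are, up to
  scaling, the norms of all nonconstant linear polynomials in \<open>A\<close>, and modulo \<open>p\<close> this is all there is.

  Otherwise \<open>A\<close> and \<open>B\<close> are \<open>3 \<times> 3\<close> matrices with the same characteristic polynomial. The squared
  singular values of \<open>M\<close> are the zeros of \<open>t\<^sup>3 - \<parallel>M\<parallel>\<^sub>F\<^sup>2 t\<^sup>2 + \<parallel>adj M\<parallel>\<^sub>F\<^sup>2 t - |det M|\<^sup>2\<close>. Subtracting these
  cubics for \<open>z - A\<close> and \<open>z - B\<close> at the common zero \<open>\<sigma>\<^sub>A(z)\<^sup>2\<close> expresses \<open>\<alpha> \<sigma>\<^sub>A(z)\<^sup>2\<close>, where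
  \<open>\<alpha> = \<parallel>A\<parallel>\<^sub>F\<^sup>2 - \<parallel>B\<parallel>\<^sub>F\<^sup>2\<close>, as \<open>\<alpha> |w|\<^sup>2 + 2 Re (\<beta> cnj w) + \<gamma>\<close> with \<open>w = z - tr A\<close>. If \<open>\<alpha> \<noteq> 0\<close>, then
  \<open>\<sigma>\<^sub>A(z) = |z - \<lambda>|\<close>, so \<open>x - \<lambda>\<close> would annihilate \<open>A\<close> as it does the scalar matrix \<open>\<lambda>\<close>. Hence \<open>\<alpha> = \<beta> = \<gamma> = 0\<close>,
  the Frobenius norms of \<open>p(A)\<close> and \<open>p(B)\<close> agree for every \<open>p\<close>, and so do the cubics above.
\<close>

section \<open>Polynomials in a matrix\<close>

lemma mat_nth: "mat c $ i $ j = (if i = j then c else 0)"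
  by (simp add: mat_def)

lemma mat_eq_0_iff [simp]: "mat c = 0 \<longleftrightarrow> c = 0"
  by (auto simp: vec_eq_iff mat_nth)

lemma mat_mult_nth [simp]: "(mat c ** M) $ i $ j = c * M $ i $ j"
  for M :: "'a::comm_semiring_1^'m^'n"
  by (simp add: matrix_matrix_mult_def mat_nth if_distrib[where f = "\<lambda>x. x * _"] cong: if_cong)

lemma mult_mat_commute: "M ** mat c = mat c ** M"
  for M :: "'a::comm_semiring_1^'n^'n"
  by (simp add: vec_eq_iff matrix_matrix_mult_def mat_nth if_distrib[where f = "\<lambda>x. _ * x"]
      if_distrib[where f = "\<lambda>x. x * _"] mult.commute cong: if_cong)

lemma matrix_mult_mat_left_commute: "M ** (mat c ** N) = mat c ** (M ** N)"
  for M N :: "'a::comm_semiring_1^'n^'n"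
  by (metis matrix_mul_assoc mult_mat_commute)

lemma mat_add: "mat (a + b) = (mat a + mat b :: 'a::monoid_add^'n^'n)"
  by (simp add: vec_eq_iff mat_nth)

lemma mat_diff: "mat (a - b) = (mat a - mat b :: 'a::group_add^'n^'n)"
  by (simp add: vec_eq_iff mat_nth)

lemma mat_mult_mat: "mat (a * b) = (mat a ** mat b :: 'a::comm_semiring_1^'n^'n)"
  by (simp add: vec_eq_iff mat_nth)

lemma matrix_add_rdistrib: "(M + N) ** P = M ** P + N ** P"
  by (simp add: vec_eq_iff matrix_matrix_mult_def distrib_right sum.distrib)

lemma mat_mult_vec: "mat c *v x = c *s x" for x :: "'a::comm_semiring_1^'n"
  by (simp add: vec_eq_iff matrix_vector_mult_def mat_nth if_distrib[where f = "\<lambda>x. x * _"]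
      cong: if_cong)

lemma poly_mat_nth:
  assumes "degree p \<le> n"
  shows "poly_mat p A $ i $ j = (\<Sum>k\<le>n. coeff p k * mat_pow A k $ i $ j)"
  unfolding poly_mat_def vec_lambda_beta
  by (rule sum.mono_neutral_left) (use assms in \<open>auto simp: coeff_eq_0\<close>)

lemma poly_mat_0 [simp]: "poly_mat 0 A = 0"
  by (simp add: poly_mat_def vec_eq_iff)

lemma poly_mat_pCons: "poly_mat (pCons a p) A = mat a + A ** poly_mat p A"
proof -
  have "poly_mat (pCons a p) A $ i $ j = (mat a + A ** poly_mat p A) $ i $ j" for i j
  proof -
    have "poly_mat (pCons a p) A $ i $ j =
        (\<Sum>k\<le>Suc (degree p). coeff (pCons a p) k * mat_pow A k $ i $ j)"
      by (rule poly_mat_nth) (simp add: degree_pCons_le)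
    also have "\<dots> = a * mat 1 $ i $ j + (\<Sum>k\<le>degree p. coeff p k * (A ** mat_pow A k) $ i $ j)"
      by (subst sum.atMost_Suc_shift) simp
    also have "(\<Sum>k\<le>degree p. coeff p k * (A ** mat_pow A k) $ i $ j) =
        (\<Sum>l\<in>UNIV. \<Sum>k\<le>degree p. A $ i $ l * (coeff p k * mat_pow A k $ l $ j))"
      by (subst sum.swap) (simp add: matrix_matrix_mult_def sum_distrib_left mult_ac)
    also have "\<dots> = (A ** poly_mat p A) $ i $ j"
      by (simp add: matrix_matrix_mult_def poly_mat_nth[OF order_refl] sum_distrib_left)
    finally show ?thesis
      by (simp add: mat_nth)
  qed
  then show ?thesis
    by (simp add: vec_eq_iff)
qed

lemma poly_mat_add [simp]: "poly_mat (p + q) A = poly_mat p A + poly_mat q A"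
  by (induction p q rule: poly_induct2) (simp_all add: poly_mat_pCons mat_add matrix_add_ldistrib)

lemma poly_mat_smult [simp]: "poly_mat (smult c p) A = mat c ** poly_mat p A"
  by (induction p)
     (simp_all add: poly_mat_pCons matrix_add_ldistrib mat_mult_mat matrix_mult_mat_left_commute)

lemma poly_mat_mult [simp]: "poly_mat (p * q) A = poly_mat p A ** poly_mat q A"
  by (induction p) (simp_all add: poly_mat_pCons matrix_add_rdistrib matrix_mul_assoc)

lemma poly_mat_diff [simp]: "poly_mat (p - q) A = poly_mat p A - poly_mat q A"
  using poly_mat_add[of "p - q" q A] by (simp add: eq_diff_eq)

lemma poly_mat_const [simp]: "poly_mat [:c:] A = mat c"
  by (simp add: poly_mat_pCons)

lemma poly_mat_linear: "poly_mat [:a, b:] A = mat a + mat b ** A"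
  by (simp add: poly_mat_pCons mult_mat_commute)

lemma poly_mat_quadratic: "poly_mat [:a, b, c:] A = mat a + mat b ** A + mat c ** (A ** A)"
  by (simp add: poly_mat_pCons matrix_add_ldistrib mult_mat_commute matrix_mult_mat_left_commute)

lemma poly_mat_monom: "poly_mat (monom c k) A = mat c ** mat_pow A k"
  by (induction k) (simp_all add: monom_0 monom_Suc poly_mat_pCons matrix_mult_mat_left_commute)

lemma poly_mat_sum: "poly_mat (\<Sum>k\<in>S. f k) A = (\<Sum>k\<in>S. poly_mat (f k) A)"
  by (induction S rule: infinite_finite_induct) simp_all

lemma poly_mat_mod:
  assumes "poly_mat m A = 0"
  shows "poly_mat (p mod m) A = poly_mat p A"
proof -
  have "poly_mat p A = poly_mat (p div m * m + p mod m) A"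
    by simp
  also have "\<dots> = poly_mat (p mod m) A"
    by (simp only: poly_mat_add poly_mat_mult assms) simp
  finally show ?thesis ..
qed

lemma mat_minus_eq_poly_mat: "mat z - A = poly_mat [:z, - 1:] A"
  by (simp add: poly_mat_linear vec_eq_iff)

text \<open>This makes \<open>poly_mat (synthetic_div p z) A / poly p z\<close> the resolvent when \<open>p\<close> annihilates \<open>A\<close>.\<close>

lemma mat_minus_mult_synthetic_div:
  "(mat z - A) ** poly_mat (synthetic_div p z) A = mat (poly p z) - poly_mat p A"
proof -
  have "[:z, - 1:] * synthetic_div p z = [:poly p z:] - p"
  proof -
    have "[:- z, 1:] * synthetic_div p z = p - [:poly p z:]"
      by (simp only: synthetic_div_correct' eq_diff_eq)
    moreover have "[:z, - 1:] = - [:- z, 1:]"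
      by simp
    ultimately show ?thesis
      by (simp only: mult_minus_left minus_diff_eq)
  qed
  then show ?thesis
    by (metis mat_minus_eq_poly_mat poly_mat_const poly_mat_diff poly_mat_mult)
qed

section \<open>Annihilating polynomials\<close>

lemma ex_annihilator: "\<exists>p. p \<noteq> 0 \<and> poly_mat p A = 0" for A :: "complex^'n^'n"
proof (cases "inj (mat_pow A)")
  case True
  define S where "S = mat_pow A ` {..DIM(complex^'n^'n)}"
  have "finite S" and "card S > DIM(complex^'n^'n)"
    using True by (simp_all add: S_def card_image inj_on_subset)
  then obtain u M where u: "(\<Sum>N\<in>S. u N *\<^sub>R N) = 0" and M: "M \<in> S" "u M \<noteq> 0"
    using dependent_biggerset[of S] real_vector.dependent_finite[of S] by auto
  define p where "p = (\<Sum>k\<le>DIM(complex^'n^'n). monom (complex_of_real (u (mat_pow A k))) k)"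
  have "poly_mat p A = (\<Sum>k\<le>DIM(complex^'n^'n). u (mat_pow A k) *\<^sub>R mat_pow A k)"
    by (simp add: p_def poly_mat_sum poly_mat_monom vec_eq_iff) (simp add: scaleR_conv_of_real)
  also have "\<dots> = 0"
    using u True by (simp add: S_def sum.reindex inj_on_subset)
  finally have "poly_mat p A = 0" .
  moreover from M obtain k where "k \<le> DIM(complex^'n^'n)" "M = mat_pow A k"
    by (auto simp: S_def)
  with M have "coeff p k \<noteq> 0"
    by (simp add: p_def coeff_sum)
  ultimately show ?thesis
    by (metis coeff_0)
next
  case False
  then obtain i j where "i \<noteq> j" "mat_pow A i = mat_pow A j"
    by (auto simp: inj_def)
  then have "monom 1 i - monom 1 j \<noteq> (0 :: complex poly)"
    and "poly_mat (monom 1 i - monom 1 j) A = 0"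
    by (simp_all add: monom_eq_iff' poly_mat_monom)
  then show ?thesis
    by blast
qed

text \<open>The minimal polynomial of \<open>A\<close> up to a scalar factor.\<close>

definition least_annihilator :: "complex^'n^'n \<Rightarrow> complex poly \<Rightarrow> bool" where
  "least_annihilator A p \<longleftrightarrow> p \<noteq> 0 \<and> poly_mat p A = 0 \<and>
     (\<forall>q. q \<noteq> 0 \<longrightarrow> poly_mat q A = 0 \<longrightarrow> degree p \<le> degree q)"

lemma ex_least_annihilator: "\<exists>p. least_annihilator A p"
  using ex_has_least_nat[of "\<lambda>p. p \<noteq> 0 \<and> poly_mat p A = 0" _ degree] ex_annihilator[of A]
  unfolding least_annihilator_def by metis

lemma poly_mat_synthetic_div_nonzero:
  fixes A :: "complex^'n^'n"
  assumes "least_annihilator A p"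
  shows "poly_mat (synthetic_div p z) A \<noteq> 0"
proof -
  have "degree p > 0"
    using assms by (auto simp: least_annihilator_def elim!: degree_eq_zeroE intro!: gr0I)
  then have "synthetic_div p z \<noteq> 0" "degree (synthetic_div p z) < degree p"
    by (simp_all add: synthetic_div_eq_0_iff degree_synthetic_div)
  then show ?thesis
    using assms by (auto simp: least_annihilator_def)
qed

section \<open>Properties holding off a finite set\<close>

lemma at_le_cofinite: "at x \<le> cofinite" for x :: "'a::t1_space"
proof (rule filter_leI)
  fix P :: "'a \<Rightarrow> bool"
  assume "eventually P cofinite"
  then have "finite ({y. \<not> P y} - {x})"
    by (simp add: eventually_cofinite)
  then have "open (- ({y. \<not> P y} - {x}))"
    by (intro open_Compl finite_imp_closed)
  then show "eventually P (at x)"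
    unfolding eventually_at_topological by (intro exI[of _ "- ({y. \<not> P y} - {x})"]) auto
qed

lemma le_if_MOST_le:
  fixes f g :: "'a::{t1_space, perfect_space} \<Rightarrow> real"
  assumes "continuous_on UNIV f" "continuous_on UNIV g" "MOST x. f x \<le> g x"
  shows "f x \<le> g x"
proof (rule tendsto_le[of "at x"])
  show "(f \<longlongrightarrow> f x) (at x)" "(g \<longlongrightarrow> g x) (at x)"
    using assms(1,2) by (simp_all add: continuous_on_def)
  show "eventually (\<lambda>x. f x \<le> g x) (at x)"
    using at_le_cofinite assms(3) by (rule filter_leD)
qed simp

lemma eq_if_MOST_eq:
  fixes f g :: "'a::{t1_space, perfect_space} \<Rightarrow> real"
  assumes "continuous_on UNIV f" "continuous_on UNIV g" "MOST x. f x = g x"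
  shows "f x = g x"
  using assms by (intro antisym le_if_MOST_le) (auto elim: eventually_mono)

lemma MOST_poly_nonzero: "p \<noteq> 0 \<Longrightarrow> MOST z. poly p z \<noteq> 0"
  for p :: "'a::idom poly"
  by (simp add: eventually_cofinite poly_roots_finite)

section \<open>The spectral norm\<close>

lemma norm_vector_scalar_mult: "norm (c *s x) = norm c * norm x" for x :: "complex^'n"
  by (simp add: norm_vec_def L2_set_def norm_mult power_mult_distrib flip: sum_distrib_left)
     (simp add: real_sqrt_mult)

lemma norm_matrix_vector_mult_le: "norm (M *v x) \<le> spec_norm M * norm x"
  unfolding spec_norm_def by (rule onorm) simp

lemma spec_norm_least: "(\<And>x. norm (M *v x) \<le> b * norm x) \<Longrightarrow> spec_norm M \<le> b"
  unfolding spec_norm_def by (rule onorm_le)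

lemma spec_norm_nonneg: "0 \<le> spec_norm M"
  unfolding spec_norm_def by (rule onorm_pos_le) simp

lemma spec_norm_eq_0_iff: "spec_norm M = 0 \<longleftrightarrow> M = 0"
  by (simp add: spec_norm_def onorm_eq_0 matrix_eq)

lemma spec_norm_mat_mult: "spec_norm (mat c ** M) = norm c * spec_norm M"
proof -
  have "spec_norm (mat c ** M) = onorm (\<lambda>x. norm c *\<^sub>R (M *v x))"
    by (simp add: spec_norm_def onorm_def mat_mult_vec norm_vector_scalar_mult
        flip: matrix_vector_mul_assoc)
  then show ?thesis
    by (simp add: onorm_scaleR spec_norm_def)
qed

lemma spec_norm_mat: "spec_norm (mat c) = norm c"
  using spec_norm_mat_mult[of c "mat 1"] by (simp add: spec_norm_def onorm_id)

lemma convex_on_spec_norm: "convex_on UNIV spec_norm"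
proof (rule convex_onI)
  fix t :: real and M N :: "complex^'n^'n"
  assume t: "0 < t" "t < 1"
  let ?f = "\<lambda>x. (1 - t) *\<^sub>R (M *v x)" and ?g = "\<lambda>x. t *\<^sub>R (N *v x)"
  have "((1 - t) *\<^sub>R M + t *\<^sub>R N) *v x = ?f x + ?g x" for x
    by (simp add: vec_eq_iff matrix_vector_mult_def sum.distrib scaleR_sum_right distrib_right)
  then have "spec_norm ((1 - t) *\<^sub>R M + t *\<^sub>R N) = onorm (\<lambda>x. ?f x + ?g x)"
    by (simp add: spec_norm_def)
  also have "\<dots> \<le> onorm ?f + onorm ?g"
    by (intro onorm_triangle bounded_linear_scaleR_right[THEN bounded_linear_compose]) simp_all
  finally show "spec_norm ((1 - t) *\<^sub>R M + t *\<^sub>R N) \<le> (1 - t) * spec_norm M + t * spec_norm N"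
    using t by (simp add: onorm_scaleR spec_norm_def)
qed simp

lemma continuous_on_spec_norm:
  assumes "continuous_on S f"
  shows "continuous_on S (\<lambda>z. spec_norm (f z))"
  using convex_on_continuous[OF open_UNIV convex_on_spec_norm] assms
  by (rule continuous_on_compose2) simp

lemma continuous_on_spec_norm_synthetic_div:
  "continuous_on S (\<lambda>z. spec_norm (poly_mat (synthetic_div p z) A))"
  for A :: "complex^'a^'a"
proof (rule continuous_on_spec_norm)
  show "continuous_on S (\<lambda>z. poly_mat (synthetic_div p z) A)"
  proof (induction p)
    case 0
    then show ?case
      by simp
  next
    case (pCons a p)
    have "continuous_on S (\<lambda>z. if i = j then poly p z else 0)" for i j :: 'a
      by (cases "i = j") (auto intro: continuous_intros)
    then have "continuous_on S (\<lambda>z. (\<chi> i j. if i = j then poly p z else 0) :: complex^'a^'a)"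
      by (intro continuous_on_vec_lambda)
    moreover have "continuous_on S (\<lambda>z. A ** poly_mat (synthetic_div p z) A)"
      unfolding matrix_matrix_mult_def by (intro continuous_intros pCons.IH)
    ultimately show ?case
      by (simp add: poly_mat_pCons mat_def continuous_on_add)
  qed
qed

section \<open>The least singular value\<close>

text \<open>This is the minimum of \<open>norm (M *v x)\<close> over the unit sphere.\<close>

definition least_sv :: "complex^'n^'n \<Rightarrow> real" where
  "least_sv M = (if invertible M then 1 / spec_norm (matrix_inv M) else 0)"

lemma matrix_inv:
  assumes "invertible M"
  shows "M ** matrix_inv M = mat 1" and "matrix_inv M ** M = mat 1"
  using someI_ex[OF assms[unfolded invertible_def]] by (simp_all add: matrix_inv_def)

lemma spec_norm_matrix_inv_pos:
  assumes "invertible M"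
  shows "spec_norm (matrix_inv M) > 0"
proof -
  have "matrix_inv M \<noteq> 0"
    using matrix_inv(1)[OF assms] by auto
  then show ?thesis
    using spec_norm_nonneg[of "matrix_inv M"] spec_norm_eq_0_iff[of "matrix_inv M"] by linarith
qed

lemma least_sv_nonneg: "0 \<le> least_sv M"
  by (simp add: least_sv_def spec_norm_nonneg)

lemma least_sv_eq_0_iff: "least_sv M = 0 \<longleftrightarrow> \<not> invertible M"
  using spec_norm_matrix_inv_pos[of M] by (auto simp: least_sv_def)

lemma resolvent_norm_eq_iff_least_sv_eq:
  "resolvent_norm A z = resolvent_norm B z \<longleftrightarrow> least_sv (mat z - A) = least_sv (mat z - B)"
  using spec_norm_matrix_inv_pos[of "mat z - A"] spec_norm_matrix_inv_pos[of "mat z - B"]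
  by (auto simp: resolvent_norm_def least_sv_def)

lemma least_sv_le_norm: "least_sv M * norm x \<le> norm (M *v x)"
proof (cases "invertible M")
  case True
  then have "matrix_inv M *v (M *v x) = x"
    by (simp add: matrix_vector_mul_assoc matrix_inv)
  then have "norm x \<le> spec_norm (matrix_inv M) * norm (M *v x)"
    using norm_matrix_vector_mult_le[of "matrix_inv M" "M *v x"] by simp
  then show ?thesis
    using True spec_norm_matrix_inv_pos[OF True] by (simp add: least_sv_def field_simps)
qed (simp add: least_sv_def)

lemma least_sv_mult_spec_norm:
  assumes "M ** Y = mat c"
  shows "least_sv M * spec_norm Y = norm c"
proof (cases "invertible M")
  case True
  then have "Y = matrix_inv M ** mat c"
    by (metis assms matrix_inv(2) matrix_mul_assoc matrix_mul_lid)
  then have "spec_norm Y = norm c * spec_norm (matrix_inv M)"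
    by (simp add: mult_mat_commute spec_norm_mat_mult)
  then show ?thesis
    using True spec_norm_matrix_inv_pos[OF True] by (simp add: least_sv_def)
next
  case False
  have "M ** (mat (1 / c) ** Y) = mat 1" if "c \<noteq> 0"
    using assms that by (simp add: matrix_mult_mat_left_commute flip: mat_mult_mat)
  with False have "c = 0"
    by (auto simp: invertible_right_inverse)
  with False show ?thesis
    by (simp add: least_sv_def)
qed

lemma least_sv_mat: "least_sv (mat c) = norm c"
  using least_sv_mult_spec_norm[of "mat c" "mat 1" c] by (simp add: spec_norm_mat)

lemma least_sv_mult_synthetic_div:
  assumes "poly_mat p A = 0"
  shows "least_sv (mat z - A) * spec_norm (poly_mat (synthetic_div p z) A) = norm (poly p z)"
  by (rule least_sv_mult_spec_norm) (simp add: mat_minus_mult_synthetic_div assms)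

lemma MOST_invertible_mat_minus: "MOST z. invertible (mat z - A)" for A :: "complex^'n^'n"
proof -
  obtain p where p: "p \<noteq> 0" "poly_mat p A = 0"
    using ex_annihilator by blast
  have "invertible (mat z - A)" if "poly p z \<noteq> 0" for z
    using least_sv_mult_synthetic_div[OF p(2), of z] that
    by (metis least_sv_eq_0_iff mult_zero_left norm_eq_zero)
  with MOST_poly_nonzero[OF p(1)] show ?thesis
    by (rule eventually_mono)
qed

section \<open>Pseudospectra and annihilating polynomials\<close>

definition polynomially_isometric :: "complex^'n^'n \<Rightarrow> complex^'n^'n \<Rightarrow> bool" where
  "polynomially_isometric A B \<longleftrightarrow> (\<forall>p. spec_norm (poly_mat p A) = spec_norm (poly_mat p B))"

lemma least_sv_eq_if_polynomially_isometric:
  fixes A B :: "complex^'n^'n"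
  assumes "polynomially_isometric A B"
  shows "least_sv (mat z - A) = least_sv (mat z - B)"
proof -
  have iso: "spec_norm (poly_mat p A) = spec_norm (poly_mat p B)" for p
    using assms by (simp add: polynomially_isometric_def)
  obtain p where p: "least_annihilator A p"
    using ex_least_annihilator by blast
  have "poly_mat p A = 0"
    using p by (simp add: least_annihilator_def)
  moreover from this have "poly_mat p B = 0"
    using iso[of p] by (metis spec_norm_eq_0_iff)
  ultimately have "least_sv (mat z - A) * spec_norm (poly_mat (synthetic_div p z) A) =
      least_sv (mat z - B) * spec_norm (poly_mat (synthetic_div p z) A)"
    by (metis iso least_sv_mult_synthetic_div)
  then show ?thesis
    using poly_mat_synthetic_div_nonzero[OF p, of z] by (simp add: spec_norm_eq_0_iff)
qed

lemma spec_norm_synthetic_div_balance: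
  fixes A B :: "complex^'n^'n"
  assumes sv: "MOST z. least_sv (mat z - A) = least_sv (mat z - B)"
    and A: "poly_mat (p * g) A = 0" and B: "poly_mat (q * g) B = 0" and "g \<noteq> 0"
  shows "spec_norm (poly_mat (synthetic_div (p * g) z) A) * norm (poly q z) =
         spec_norm (poly_mat (synthetic_div (q * g) z) B) * norm (poly p z)"
proof -
  let ?P = "\<lambda>z. spec_norm (poly_mat (synthetic_div (p * g) z) A)"
    and ?Q = "\<lambda>z. spec_norm (poly_mat (synthetic_div (q * g) z) B)"
  show ?thesis
  proof (rule eq_if_MOST_eq[of "\<lambda>z. ?P z * norm (poly q z)" "\<lambda>z. ?Q z * norm (poly p z)"])
    show "MOST z. ?P z * norm (poly q z) = ?Q z * norm (poly p z)"
      using sv MOST_invertible_mat_minus[of A] MOST_poly_nonzero[OF \<open>g \<noteq> 0\<close>]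
    proof eventually_elim
      case (elim z)
      let ?s = "least_sv (mat z - A)"
      have P: "?s * ?P z = norm (poly p z) * norm (poly g z)"
        using least_sv_mult_synthetic_div[OF A, of z] by (simp only: poly_mult norm_mult)
      have Q: "?s * ?Q z = norm (poly q z) * norm (poly g z)"
        using least_sv_mult_synthetic_div[OF B, of z] by (simp only: poly_mult norm_mult elim(1))
      have "?s * norm (poly g z) * (?P z * norm (poly q z)) =
          (?s * ?P z) * (norm (poly q z) * norm (poly g z))"
        by simp
      also have "\<dots> = ?s * norm (poly g z) * (?Q z * norm (poly p z))"
        by (simp only: P flip: Q) simp
      finally show ?case
        using elim(2,3) by (simp add: least_sv_eq_0_iff)
    qed
  qed (intro continuous_intros continuous_on_spec_norm_synthetic_div)+
qed

text \<open>If this failed, a least annihilator \<open>p\<close> of \<open>A\<close> would have a zero \<open>x\<close> of higher order than \<open>q\<close>, and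
  \<open>(z - A)\<^sup>-\<^sup>1\<close> would grow faster than \<open>(z - B)\<^sup>-\<^sup>1\<close> as \<open>z\<close> tends to \<open>x\<close>.\<close>

lemma poly_mat_eq_0_if_MOST_least_sv_eq:
  fixes A B :: "complex^'n^'n"
  assumes sv: "MOST z. least_sv (mat z - A) = least_sv (mat z - B)" and q: "poly_mat q B = 0"
  shows "poly_mat q A = 0"
proof -
  obtain p where p: "least_annihilator A p"
    using ex_least_annihilator by blast
  then have "p \<noteq> 0" and p_A: "poly_mat p A = 0"
    by (simp_all add: least_annihilator_def)
  define g where "g = gcd p q"
  have "g \<noteq> 0"
    using \<open>p \<noteq> 0\<close> by (simp add: g_def)
  then obtain p' q' where p': "p = p' * g" and q': "q = q' * g" and "coprime p' q'"
    using gcd_coprime_exists[of p q] unfolding g_def by blast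
  have "poly p' x \<noteq> 0" for x
  proof
    assume x: "poly p' x = 0"
    then have "poly q' x \<noteq> 0"
      using coprime_poly_0[OF \<open>coprime p' q'\<close>] by auto
    moreover have "spec_norm (poly_mat (synthetic_div p x) A) * norm (poly q' x) = 0"
      using spec_norm_synthetic_div_balance[OF sv, of p' g q' x] p_A q \<open>g \<noteq> 0\<close> x
      unfolding p' q' by simp
    ultimately have "poly_mat (synthetic_div p x) A = 0"
      by (simp add: spec_norm_eq_0_iff)
    with poly_mat_synthetic_div_nonzero[OF p] show False
      by blast
  qed
  then have "degree p' = 0"
    using alg_closed_imp_poly_has_root[of p'] by auto
  then have "is_unit p'"
    using \<open>p \<noteq> 0\<close> p' by (auto simp: is_unit_iff_degree)
  then have "p dvd q"
    unfolding p' q' by (simp add: mult_unit_dvd_iff' unit_imp_dvd)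
  then show ?thesis
    using p_A by (auto simp: dvd_def)
qed

lemma polynomially_isometric_if_quadratic_annihilator:
  fixes A B :: "complex^'n^'n"
  assumes sv: "MOST z. least_sv (mat z - A) = least_sv (mat z - B)"
    and q: "q \<noteq> 0" "degree q \<le> 2" and q_A: "poly_mat q A = 0"
  shows "polynomially_isometric A B"
  unfolding polynomially_isometric_def
proof
  fix p
  have q_B: "poly_mat q B = 0"
    by (rule poly_mat_eq_0_if_MOST_least_sv_eq[OF _ q_A])
       (use sv in \<open>simp add: eventually_mono\<close>)
  define r where "r = p mod q"
  have "spec_norm (poly_mat r A) = spec_norm (poly_mat r B)"
  proof (cases "degree r = 0")
    case True
    then show ?thesis
      by (auto elim: degree_eq_zeroE)
  next
    case False
    then have "degree r < degree q"
      unfolding r_def using degree_mod_less[OF q(1), of p] by auto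
    with False q(2) have degrees: "degree r = 1" "degree q = 2"
      by linarith+
    obtain c d where r_eq: "r = [:c, d:]" and "d \<noteq> 0"
      using degree1_coeffs[OF degrees(1)] .
    obtain e f a where q_eq: "q = [:e, f, a:]" and "a \<noteq> 0"
      using degree2_coeffs[OF degrees(2)] .
    define z where "z = (c * a / d - f) / a"
    have "r = smult (d / a) (synthetic_div q z)"
      using \<open>a \<noteq> 0\<close> \<open>d \<noteq> 0\<close> by (simp add: r_eq q_eq z_def)
    moreover have "spec_norm (poly_mat (synthetic_div q z) A) =
        spec_norm (poly_mat (synthetic_div q z) B)"
      using spec_norm_synthetic_div_balance[OF sv, of 1 q 1 z] q(1) q_A q_B by simp
    ultimately show ?thesis
      by (simp add: spec_norm_mat_mult)
  qed
  then show "spec_norm (poly_mat p A) = spec_norm (poly_mat p B)"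
    by (simp add: r_def poly_mat_mod q_A q_B)
qed

section \<open>Resolvents like those of scalar matrices\<close>

lemma complex_eq_0_if_Re_bounded_above:
  fixes k :: complex
  assumes "\<And>z. Re (cnj z * k) \<le> d"
  shows "k = 0"
proof (rule ccontr)
  assume "k \<noteq> 0"
  have "Re (cnj (of_real r * k) * k) = r * (norm k)\<^sup>2" for r
    by (simp add: cmod_power2) (simp add: power2_eq_square algebra_simps)
  then have "r * (norm k)\<^sup>2 \<le> d" for r
    using assms by metis
  from this[of "(d + 1) / (norm k)\<^sup>2"] show False
    using \<open>k \<noteq> 0\<close> by simp
qed

lemma quadratic_eq_dist_square:
  fixes b k w :: complex and c :: real
  defines "Q \<equiv> \<lambda>w. (norm w)\<^sup>2 + 2 * Re (cnj w * b) + c"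
  assumes nonneg: "\<And>w. 0 \<le> Q w" and le: "\<And>w. Q w \<le> (norm (w - k))\<^sup>2"
  shows "Q w = (norm (w - k))\<^sup>2"
proof -
  have diff: "Q w - (norm (w - k))\<^sup>2 = Re (cnj w * (2 * (b + k))) + (c - (norm k)\<^sup>2)" for w
    by (simp add: Q_def cmod_power2) (simp add: algebra_simps power2_eq_square)
  have "Re (cnj w * (2 * (b + k))) \<le> (norm k)\<^sup>2 - c" for w
    using diff[of w] le[of w] by linarith
  then have "2 * (b + k) = 0"
    by (rule complex_eq_0_if_Re_bounded_above)
  then have offset: "Q w - (norm (w - k))\<^sup>2 = c - (norm k)\<^sup>2" for w
    unfolding diff by (simp only: mult_zero_right) simp
  from offset[of k] have "Q k = c - (norm k)\<^sup>2"
    by simp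
  then show ?thesis
    using nonneg[of k] offset[of w] le[of w] by linarith
qed

lemma ex_least_sv_le_dist:
  fixes A :: "complex^'n^'n"
  shows "\<exists>l. \<forall>z. least_sv (mat z - A) \<le> norm (z - l)"
proof -
  obtain p where p: "least_annihilator A p"
    using ex_least_annihilator by blast
  have "degree p \<noteq> 0"
    using poly_mat_synthetic_div_nonzero[OF p, of 0] synthetic_div_eq_0_iff[of p 0] by auto
  then obtain l where l: "poly p l = 0"
    using alg_closed_imp_poly_has_root[of p] by auto
  obtain x where x: "poly_mat (synthetic_div p l) A *v x \<noteq> 0"
    using poly_mat_synthetic_div_nonzero[OF p, of l] by (auto simp: matrix_eq)
  define v where "v = poly_mat (synthetic_div p l) A *v x"
  have "(mat l - A) ** poly_mat (synthetic_div p l) A = 0"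
    using p l by (simp add: mat_minus_mult_synthetic_div least_annihilator_def)
  then have "(mat l - A) *v v = 0"
    by (simp add: v_def matrix_vector_mul_assoc)
  then have eigenvector: "A *v v = l *s v"
    by (simp add: matrix_vector_mult_diff_rdistrib mat_mult_vec)
  have "least_sv (mat z - A) \<le> norm (z - l)" for z
  proof -
    have "(mat z - A) *v v = (z - l) *s v"
      by (simp add: matrix_vector_mult_diff_rdistrib mat_mult_vec eigenvector)
    then have "least_sv (mat z - A) * norm v \<le> norm (z - l) * norm v"
      using least_sv_le_norm[of "mat z - A" v] by (simp only: norm_vector_scalar_mult)
    then show ?thesis
      using x by (simp add: v_def)
  qed
  then show ?thesis
    by blast
qed

lemma ex_least_sv_eq_dist_if_square_eq_quadratic:
  fixes A :: "complex^'n^'n"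
  assumes quadratic: "MOST z. (least_sv (mat z - A))\<^sup>2 = (norm z)\<^sup>2 + 2 * Re (cnj z * b) + c"
  shows "\<exists>l. MOST z. least_sv (mat z - A) = norm (z - l)"
proof -
  let ?Q = "\<lambda>z. (norm z)\<^sup>2 + 2 * Re (cnj z * b) + c"
  obtain l where l: "\<And>z. least_sv (mat z - A) \<le> norm (z - l)"
    using ex_least_sv_le_dist by blast
  have continuous: "continuous_on UNIV ?Q" "continuous_on UNIV (\<lambda>z. (norm (z - l))\<^sup>2)"
    by (intro continuous_intros)+
  have nonneg: "0 \<le> ?Q z" for z
    by (rule le_if_MOST_le[OF continuous_on_const continuous(1) eventually_mono[OF quadratic]])
       (metis zero_le_power2)
  have le: "?Q z \<le> (norm (z - l))\<^sup>2" for z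
    by (rule le_if_MOST_le[OF continuous eventually_mono[OF quadratic]])
       (metis l least_sv_nonneg power_mono)
  have "?Q z = (norm (z - l))\<^sup>2" for z
    using nonneg le by (rule quadratic_eq_dist_square)
  with quadratic have "MOST z. least_sv (mat z - A) = norm (z - l)"
    by (auto elim!: eventually_mono simp: least_sv_nonneg power2_eq_iff_nonneg)
  then show ?thesis
    by blast
qed

lemma eq_mat_if_MOST_least_sv_eq_dist:
  fixes A :: "complex^'n^'n"
  assumes "MOST z. least_sv (mat z - A) = norm (z - l)"
  shows "A = mat l"
proof -
  have "least_sv (mat z - mat l :: complex^'n^'n) = norm (z - l)" for z
    by (simp add: least_sv_mat flip: mat_diff)
  with assms have "MOST z. least_sv (mat z - A) = least_sv (mat z - mat l :: complex^'n^'n)"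
    by simp
  moreover have "poly_mat [:- l, 1:] (mat l :: complex^'n^'n) = 0"
    by (simp add: poly_mat_linear flip: mat_add)
  ultimately have "poly_mat [:- l, 1:] A = 0"
    by (rule poly_mat_eq_0_if_MOST_least_sv_eq)
  then have "mat l + poly_mat [:- l, 1:] A = mat l"
    by simp
  then show ?thesis
    by (simp add: poly_mat_linear flip: mat_add add.assoc)
qed

section \<open>Singular values\<close>

definition conj_transpose :: "complex^'n^'m \<Rightarrow> complex^'m^'n"  ("(_\<^sup>\<dagger>)" [1000] 1000) where
  "M\<^sup>\<dagger> = (\<chi> i j. cnj (M $ j $ i))"

lemma conj_transpose_nth [simp]: "M\<^sup>\<dagger> $ i $ j = cnj (M $ j $ i)"
  by (simp add: conj_transpose_def)

lemma conj_transpose_involutive [simp]: "M\<^sup>\<dagger>\<^sup>\<dagger> = M"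
  by (simp add: vec_eq_iff)

lemma conj_transpose_mult: "(M ** N)\<^sup>\<dagger> = N\<^sup>\<dagger> ** M\<^sup>\<dagger>"
  by (simp add: vec_eq_iff matrix_matrix_mult_def mult.commute)

lemma conj_transpose_mat: "(mat c)\<^sup>\<dagger> = mat (cnj c)"
  by (simp add: vec_eq_iff mat_nth)

lemma det_conj_transpose: "det (M\<^sup>\<dagger>) = cnj (det M)"
proof -
  have "det (M\<^sup>\<dagger>) = det (transpose (M\<^sup>\<dagger>))"
    by (simp add: det_transpose)
  also have "\<dots> = cnj (det M)"
    by (simp add: det_def transpose_def)
  finally show ?thesis .
qed

lemma inner_conj_transpose: "(M *v x) \<bullet> y = x \<bullet> (M\<^sup>\<dagger> *v y)"
proof -
  have Re_mult_cnj: "u \<bullet> v = Re (u * cnj v)" for u v :: complex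
    by (simp add: inner_complex_def)
  have "(M *v x) \<bullet> y = (\<Sum>i\<in>UNIV. \<Sum>j\<in>UNIV. Re (M $ i $ j * x $ j * cnj (y $ i)))"
    by (simp only: inner_vec_def matrix_vector_mult_def Re_mult_cnj vec_lambda_beta
        sum_distrib_right Re_sum)
  also have "\<dots> = (\<Sum>j\<in>UNIV. \<Sum>i\<in>UNIV. Re (M $ i $ j * x $ j * cnj (y $ i)))"
    by (rule sum.swap)
  also have "\<dots> = x \<bullet> (M\<^sup>\<dagger> *v y)"
    by (simp only: inner_vec_def matrix_vector_mult_def Re_mult_cnj vec_lambda_beta
        conj_transpose_nth sum_distrib_left Re_sum cnj_sum complex_cnj_mult complex_cnj_cnj mult_ac)
  finally show ?thesis .
qed

lemma spec_norm_conj_transpose_le: "spec_norm (M\<^sup>\<dagger>) \<le> spec_norm M" for M :: "complex^'n^'n"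
proof (rule spec_norm_least)
  fix y :: "complex^'n"
  have "(norm (M\<^sup>\<dagger> *v y))\<^sup>2 = (M *v (M\<^sup>\<dagger> *v y)) \<bullet> y"
    by (simp add: power2_norm_eq_inner inner_conj_transpose)
  also have "\<dots> \<le> norm (M *v (M\<^sup>\<dagger> *v y)) * norm y"
    by (rule norm_cauchy_schwarz)
  also have "\<dots> \<le> (spec_norm M * norm (M\<^sup>\<dagger> *v y)) * norm y"
    by (intro mult_right_mono norm_matrix_vector_mult_le) auto
  finally show "norm (M\<^sup>\<dagger> *v y) \<le> spec_norm M * norm y"
    by (cases "M\<^sup>\<dagger> *v y = 0") (auto simp: power2_eq_square spec_norm_nonneg algebra_simps)
qed

lemma spec_norm_conj_transpose [simp]: "spec_norm (M\<^sup>\<dagger>) = spec_norm M"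
  using spec_norm_conj_transpose_le[of M] spec_norm_conj_transpose_le[of "M\<^sup>\<dagger>"] by simp

lemma spec_norm_attained:
  fixes M :: "complex^'n^'n"
  obtains x where "x \<noteq> 0" "norm (M *v x) = spec_norm M * norm x"
proof -
  have "continuous_on (sphere (0 :: complex^'n) 1) (\<lambda>x. norm (M *v x))"
    by (intro continuous_on_norm linear_continuous_on) simp
  moreover have "sphere (0 :: complex^'n) 1 \<noteq> {}"
    by simp
  ultimately obtain x where x: "norm x = 1" "\<And>y. norm y = 1 \<Longrightarrow> norm (M *v y) \<le> norm (M *v x)"
    using continuous_attains_sup[OF compact_sphere] by (metis mem_sphere_0)
  have "spec_norm M \<le> norm (M *v x)"
  proof (rule spec_norm_least)
    fix y :: "complex^'n"
    show "norm (M *v y) \<le> norm (M *v x) * norm y"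
    proof (cases "y = 0")
      case False
      then have "norm (M *v (y /\<^sub>R norm y)) \<le> norm (M *v x)"
        by (intro x(2)) simp
      then show ?thesis
        using False by (simp add: linear_cmul[OF matrix_vector_mul_linear] field_simps)
    qed simp
  qed
  then have "norm (M *v x) = spec_norm M * norm x"
    using norm_matrix_vector_mult_le[of M x] x(1) by simp
  moreover have "x \<noteq> 0"
    using x(1) by auto
  ultimately show ?thesis
    by (rule that[rotated])
qed

lemma of_real_vector_scalar_mult: "of_real r *s x = r *\<^sub>R x" for x :: "complex^'n"
  by (simp add: vec_eq_iff) (simp add: scaleR_conv_of_real)

lemma spec_norm_eigenvector:
  fixes M :: "complex^'n^'n"
  obtains x where "x \<noteq> 0" "(M\<^sup>\<dagger> ** M) *v x = of_real ((spec_norm M)\<^sup>2) *s x"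
proof -
  obtain x where x: "x \<noteq> 0" "norm (M *v x) = spec_norm M * norm x"
    by (rule spec_norm_attained)
  let ?s = "(spec_norm M)\<^sup>2" and ?y = "M\<^sup>\<dagger> *v (M *v x)"
  have "norm ?y \<le> spec_norm M * (spec_norm M * norm x)"
    using norm_matrix_vector_mult_le[of "M\<^sup>\<dagger>" "M *v x"] by (simp add: x(2))
  then have y: "(norm ?y)\<^sup>2 \<le> (?s * norm x)\<^sup>2"
    by (intro power_mono) (auto simp: power2_eq_square)
  have xy: "x \<bullet> ?y = ?s * (norm x)\<^sup>2"
    using x(2) by (simp flip: inner_conj_transpose add: power_mult_distrib flip: power2_norm_eq_inner)
  have "(norm (?y - ?s *\<^sub>R x))\<^sup>2 = (norm ?y)\<^sup>2 - 2 * ?s * (x \<bullet> ?y) + ?s\<^sup>2 * (norm x)\<^sup>2"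
    unfolding power2_norm_eq_inner
    by (simp add: inner_diff_left inner_diff_right inner_commute power2_eq_square)
  also have "\<dots> \<le> 0"
    using y by (simp add: xy algebra_simps power2_eq_square)
  finally have "?y = ?s *\<^sub>R x"
    by simp
  then have "(M\<^sup>\<dagger> ** M) *v x = of_real ?s *s x"
    by (simp only: of_real_vector_scalar_mult flip: matrix_vector_mul_assoc)
  with x(1) show ?thesis
    by (rule that)
qed

lemma det_mat_minus_eq_0_iff: "det (mat c - M) = 0 \<longleftrightarrow> (\<exists>x. x \<noteq> 0 \<and> M *v x = c *s x)"
  for M :: "'a::field^'n^'n"
proof -
  have "det (mat c - M) \<noteq> 0 \<longleftrightarrow> (\<forall>x. (mat c - M) *v x = 0 \<longrightarrow> x = 0)"
    by (simp add: invertible_left_inverse matrix_left_invertible_ker flip: invertible_det_nz)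
  moreover have "(mat c - M) *v x = 0 \<longleftrightarrow> M *v x = c *s x" for x
    by (simp add: matrix_vector_mult_diff_rdistrib mat_mult_vec) metis
  ultimately show ?thesis
    by blast
qed

lemma det_spec_norm: "det (mat (of_real ((spec_norm M)\<^sup>2)) - M\<^sup>\<dagger> ** M) = 0"
  unfolding det_mat_minus_eq_0_iff using spec_norm_eigenvector[of M] by blast

lemma singular_value_le_spec_norm:
  fixes M :: "complex^'n^'n"
  assumes "det (mat (of_real (s\<^sup>2)) - M\<^sup>\<dagger> ** M) = 0" "0 \<le> s"
  shows "s \<le> spec_norm M"
proof -
  obtain x where x: "x \<noteq> 0" "M\<^sup>\<dagger> *v (M *v x) = s\<^sup>2 *\<^sub>R x"
    using assms(1) unfolding det_mat_minus_eq_0_iff of_real_vector_scalar_mult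
    by (auto simp: matrix_vector_mul_assoc)
  then have "(norm (M *v x))\<^sup>2 = (s * norm x)\<^sup>2"
    by (simp add: power2_norm_eq_inner inner_conj_transpose power_mult_distrib)
  then have "norm (M *v x) = s * norm x"
    using assms(2) by (simp add: power2_eq_iff_nonneg)
  then show ?thesis
    using norm_matrix_vector_mult_le[of M x] x(1) by simp
qed

lemma spec_norm_eq_if_det_eq:
  fixes M N :: "complex^'n^'n"
  assumes "\<And>t. det (mat (complex_of_real t) - M\<^sup>\<dagger> ** M) = det (mat (of_real t) - N\<^sup>\<dagger> ** N)"
  shows "spec_norm M = spec_norm N"
proof (rule antisym)
  show "spec_norm M \<le> spec_norm N"
    using det_spec_norm[of M] assms by (intro singular_value_le_spec_norm spec_norm_nonneg) metis
  show "spec_norm N \<le> spec_norm M"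
    using det_spec_norm[of N] assms by (intro singular_value_le_spec_norm spec_norm_nonneg) metis
qed

lemma det_least_sv: "det (mat (of_real ((least_sv M)\<^sup>2)) - M\<^sup>\<dagger> ** M) = 0" for M :: "complex^'n^'n"
proof (cases "invertible M")
  case False
  then obtain x where "x \<noteq> 0" "M *v x = 0"
    unfolding invertible_left_inverse matrix_left_invertible_ker by blast
  moreover from this have "(M\<^sup>\<dagger> ** M) *v x = of_real ((least_sv M)\<^sup>2) *s x"
    using False by (simp add: least_sv_def flip: matrix_vector_mul_assoc)
  ultimately show ?thesis
    unfolding det_mat_minus_eq_0_iff by blast
next
  case True
  define R where "R = matrix_inv M"
  let ?s = "complex_of_real ((spec_norm R)\<^sup>2)"
  obtain x where x: "x \<noteq> 0" "(R ** R\<^sup>\<dagger>) *v x = ?s *s x"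
    using spec_norm_eigenvector[of "R\<^sup>\<dagger>"] by auto
  have "(M\<^sup>\<dagger> ** M) ** (R ** R\<^sup>\<dagger>) = M\<^sup>\<dagger> ** (M ** R) ** R\<^sup>\<dagger>"
    by (simp only: matrix_mul_assoc)
  also have "\<dots> = (R ** M)\<^sup>\<dagger>"
    by (simp add: R_def matrix_inv(1)[OF True] conj_transpose_mult)
  also have "\<dots> = mat 1"
    by (simp add: R_def matrix_inv(2)[OF True] conj_transpose_mat)
  finally have "x = (M\<^sup>\<dagger> ** M) *v (?s *s x)"
    by (metis x(2) matrix_vector_mul_assoc matrix_vector_mul_lid)
  then have "x = ?s *s ((M\<^sup>\<dagger> ** M) *v x)"
    by (simp only: vec.scale)
  then have "(1 / ?s) *s x = (1 / ?s * ?s) *s ((M\<^sup>\<dagger> ** M) *v x)"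
    by (metis vector_smult_assoc)
  then have "(M\<^sup>\<dagger> ** M) *v x = (1 / ?s) *s x"
    using spec_norm_matrix_inv_pos[OF True] by (simp add: R_def)
  then show ?thesis
    unfolding det_mat_minus_eq_0_iff using x(1) True
    by (auto simp: least_sv_def R_def power_divide)
qed

section \<open>Characteristic polynomials in dimensions two and three\<close>

lemma det_two:
  fixes A :: "'a::comm_ring_1^'n^'n"
  assumes "UNIV = {i, j :: 'n}" "i \<noteq> j"
  shows "det A = A$i$i * A$j$j - A$i$j * A$j$i"
proof -
  have fin: "finite {j}" "i \<notin> {j}"
    using assms by auto
  show ?thesis
    unfolding det_def assms(1) sum_over_permutations_insert[OF fin] permutes_sing
    using assms(2)
    by (simp add: sign_swap_id permutation_swap_id sign_compose sign_id swap_id_eq)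
qed

lemma det_three:
  fixes A :: "'a::comm_ring_1^'n^'n"
  assumes "UNIV = {i, j, k :: 'n}" "i \<noteq> j" "j \<noteq> k" "i \<noteq> k"
  shows "det A =
    A$i$i * A$j$j * A$k$k + A$i$j * A$j$k * A$k$i + A$i$k * A$j$i * A$k$j
    - A$i$i * A$j$k * A$k$j - A$i$j * A$j$i * A$k$k - A$i$k * A$j$j * A$k$i"
proof -
  have fin: "finite {j, k}" "i \<notin> {j, k}" "finite {k}" "j \<notin> {k}"
    using assms by auto
  show ?thesis
    unfolding det_def assms(1) sum_over_permutations_insert[OF fin(1,2)]
      sum_over_permutations_insert[OF fin(3,4)] permutes_sing
    using assms(2-4) assms(2-4)[symmetric]
    by (simp add: sign_swap_id permutation_swap_id sign_compose sign_id swap_id_eq)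
qed

lemma cayley_hamilton_two:
  fixes A :: "complex^'n^'n"
  assumes "CARD('n) = 2"
  shows "poly_mat [:det A, - trace A, 1:] A = 0"
proof -
  obtain i j :: 'n where univ: "UNIV = {i, j}" and ne: "i \<noteq> j"
    using assms card_2_iff[of "UNIV :: 'n set"] by metis
  have all_iff: "(\<forall>x. P x) \<longleftrightarrow> P i \<and> P j" for P
    using univ by (metis UNIV_I empty_iff insert_iff)
  show ?thesis
    unfolding poly_mat_quadratic vec_eq_iff all_iff det_two[OF univ ne] trace_def
    using ne ne[symmetric] by (simp add: matrix_matrix_mult_def mat_nth univ algebra_simps)
qed

text \<open>The second elementary symmetric polynomial in the eigenvalues.\<close>

definition sym2 :: "complex^'n^'n \<Rightarrow> complex" where
  "sym2 M = ((trace M)\<^sup>2 - trace (M ** M)) / 2"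

definition charpoly3 :: "complex^'n^'n \<Rightarrow> complex poly" where
  "charpoly3 A = [:- det A, sym2 A, - trace A, 1:]"

text \<open>For \<open>3 \<times> 3\<close> matrices this is the adjugate, by the Cayley--Hamilton theorem.\<close>

definition adj3 :: "complex^'n^'n \<Rightarrow> complex^'n^'n" where
  "adj3 M = M ** M - mat (trace M) ** M + mat (sym2 M)"

lemma poly_charpoly3:
  fixes A :: "complex^'n^'n"
  assumes "CARD('n) = 3"
  shows "poly (charpoly3 A) z = det (mat z - A)"
proof -
  obtain i j k :: 'n where univ: "UNIV = {i, j, k}" and ne: "i \<noteq> j" "j \<noteq> k" "i \<noteq> k"
    using assms card_3_iff[of "UNIV :: 'n set"] by metis
  show ?thesis
    unfolding det_three[OF univ ne] charpoly3_def sym2_def trace_def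
    using ne ne[symmetric]
    by (simp add: matrix_matrix_mult_def mat_nth univ)
       (simp add: field_simps power2_eq_square power3_eq_cube)
qed

lemma mult_adj3:
  fixes M :: "complex^'n^'n"
  assumes "CARD('n) = 3"
  shows "M ** adj3 M = mat (det M)"
proof -
  obtain i j k :: 'n where univ: "UNIV = {i, j, k}" and ne: "i \<noteq> j" "j \<noteq> k" "i \<noteq> k"
    using assms card_3_iff[of "UNIV :: 'n set"] by metis
  have all_iff: "(\<forall>x. P x) \<longleftrightarrow> P i \<and> P j \<and> P k" for P
    using univ by (metis UNIV_I empty_iff insert_iff)
  show ?thesis
    unfolding vec_eq_iff all_iff det_three[OF univ ne] adj3_def sym2_def trace_def
    using ne ne[symmetric]
    by (simp add: matrix_matrix_mult_def mat_nth univ)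
       (intro conjI; simp add: field_simps power2_eq_square)
qed

lemma cayley_hamilton_three:
  fixes A :: "complex^'n^'n"
  assumes "CARD('n) = 3"
  shows "poly_mat (charpoly3 A) A = 0"
proof -
  have "poly_mat (charpoly3 A) A = mat (- det A) + A ** poly_mat [:sym2 A, - trace A, 1:] A"
    unfolding charpoly3_def by (rule poly_mat_pCons)
  also have "poly_mat [:sym2 A, - trace A, 1:] A = adj3 A"
    unfolding poly_mat_quadratic adj3_def by (simp add: vec_eq_iff)
  finally show ?thesis
    by (simp add: mult_adj3[OF assms] flip: mat_add)
qed

lemma trace_mat: "trace (mat c :: complex^'n^'n) = of_nat CARD('n) * c"
  by (simp add: trace_def mat_nth)

lemma trace_mat_mult: "trace (mat c ** M) = c * trace M" for M :: "complex^'n^'n"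
  by (simp add: trace_def sum_distrib_left)

lemma synthetic_div_charpoly3:
  "synthetic_div (charpoly3 A) z = [:z\<^sup>2 - trace A * z + sym2 A, z - trace A, 1:]"
  by (simp add: charpoly3_def algebra_simps power2_eq_square)

lemma adj3_mat_minus:
  fixes A :: "complex^'n^'n"
  assumes "CARD('n) = 3"
  shows "adj3 (mat z - A) = poly_mat (synthetic_div (charpoly3 A) z) A"
proof -
  have square: "(mat z - A) ** (mat z - A) = mat (z\<^sup>2) - mat (2 * z) ** A + A ** A"
  proof -
    have "(mat z - A) ** (mat z - A) = poly_mat ([:z, - 1:] * [:z, - 1:]) A"
      by (simp only: mat_minus_eq_poly_mat poly_mat_mult)
    also have "\<dots> = mat (z\<^sup>2) - mat (2 * z) ** A + A ** A"
      by (simp add: poly_mat_quadratic vec_eq_iff power2_eq_square)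
    finally show ?thesis .
  qed
  have trace: "trace (mat z - A) = 3 * z - trace A"
    by (simp add: trace_sub trace_mat assms)
  have sym2: "sym2 (mat z - A) = 3 * z\<^sup>2 - 2 * z * trace A + sym2 A"
    unfolding sym2_def square trace
    by (simp add: trace_add trace_sub trace_mat trace_mat_mult assms field_simps power2_eq_square)
  show ?thesis
    unfolding adj3_def square trace sym2 synthetic_div_charpoly3
    by (simp add: poly_mat_quadratic vec_eq_iff mat_nth algebra_simps power2_eq_square)
qed

section \<open>The Frobenius inner product\<close>

definition frob_inner :: "complex^'n^'m \<Rightarrow> complex^'n^'m \<Rightarrow> complex" where
  "frob_inner M N = (\<Sum>i\<in>UNIV. \<Sum>j\<in>UNIV. M $ i $ j * cnj (N $ i $ j))"

lemma frob_inner_add_left [simp]: "frob_inner (M + N) P = frob_inner M P + frob_inner N P"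
  by (simp add: frob_inner_def distrib_right sum.distrib)

lemma frob_inner_add_right [simp]: "frob_inner P (M + N) = frob_inner P M + frob_inner P N"
  by (simp add: frob_inner_def distrib_left sum.distrib)

lemma frob_inner_scale_left [simp]: "frob_inner (mat c ** M) N = c * frob_inner M N"
  by (simp add: frob_inner_def sum_distrib_left mult_ac)

lemma frob_inner_scale_right [simp]: "frob_inner M (mat c ** N) = cnj c * frob_inner M N"
  by (simp add: frob_inner_def sum_distrib_left mult_ac)

lemma cnj_frob_inner: "cnj (frob_inner M N) = frob_inner N M"
  by (simp add: frob_inner_def mult.commute)

lemma frob_inner_mat_right [simp]: "frob_inner M (mat c) = cnj c * trace M"
  by (simp add: frob_inner_def mat_nth trace_def sum_distrib_left if_distrib[where f = cnj]
      if_distrib[where f = "\<lambda>x. _ * x"] mult.commute cong: if_cong)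

lemma frob_inner_mat_left [simp]: "frob_inner (mat c) M = c * cnj (trace M)"
  by (metis cnj_frob_inner complex_cnj_cnj complex_cnj_mult frob_inner_mat_right)

lemma frob_inner_self: "frob_inner M M = of_real ((norm M)\<^sup>2)"
  by (simp add: frob_inner_def norm_vec_def L2_set_def sum_nonneg flip: complex_norm_square)

lemma norm_add_square: "(norm (M + N))\<^sup>2 = (norm M)\<^sup>2 + 2 * Re (frob_inner M N) + (norm N)\<^sup>2"
  for M N :: "complex^'n^'m"
proof -
  have "frob_inner (M + N) (M + N) =
      frob_inner M M + (frob_inner M N + cnj (frob_inner M N)) + frob_inner N N"
    by (simp add: cnj_frob_inner)
  then have "complex_of_real ((norm (M + N))\<^sup>2) =
      of_real ((norm M)\<^sup>2 + 2 * Re (frob_inner M N) + (norm N)\<^sup>2)"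
    by (simp only: frob_inner_self complex_add_cnj flip: of_real_add)
  then show ?thesis
    by (simp only: of_real_eq_iff)
qed

lemma trace_eq_if_norm_add_mat_eq:
  fixes M N :: "complex^'n^'n"
  assumes "\<And>c. norm (M + mat c) = norm (N + mat c)"
  shows "trace M = trace N"
proof -
  have "norm M = norm N"
    using assms[of 0] by simp
  then have Re_eq: "Re (cnj c * trace M) = Re (cnj c * trace N)" for c
    using norm_add_square[of M "mat c"] norm_add_square[of N "mat c"] assms[of c] by simp
  show ?thesis
    using Re_eq[of 1] Re_eq[of \<i>] by (simp add: complex_eq_iff)
qed

lemma norm_poly_mat_quadratic_diff:
  fixes A B :: "complex^'n^'n"
  assumes "trace A = trace B" "trace (A ** A) = trace (B ** B)"
  shows "(norm (poly_mat [:a, b, c:] A))\<^sup>2 - (norm (poly_mat [:a, b, c:] B))\<^sup>2 =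
     (norm b)\<^sup>2 * ((norm A)\<^sup>2 - (norm B)\<^sup>2)
   + 2 * Re (cnj b * c * (frob_inner (A ** A) A - frob_inner (B ** B) B))
   + (norm c)\<^sup>2 * ((norm (A ** A))\<^sup>2 - (norm (B ** B))\<^sup>2)" (is "?l = ?r")
proof -
  have "complex_of_real ?l = of_real ?r"
    unfolding of_real_add of_real_diff of_real_mult[of "_\<^sup>2"] frob_inner_self[symmetric]
      complex_add_cnj[symmetric]
    by (simp add: poly_mat_quadratic assms trace_add trace_mat_mult trace_mat complex_norm_square
        cnj_frob_inner algebra_simps del: of_real_power)
  then show ?thesis
    by (simp only: of_real_eq_iff)
qed

section \<open>Singular values of three-by-three matrices\<close>

lemma adj3_nth:
  fixes M :: "complex^'n^'n"
  assumes univ: "UNIV = {i, j, k :: 'n}" and ne: "i \<noteq> j" "j \<noteq> k" "i \<noteq> k"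
  shows "adj3 M $ i $ i = M$j$j * M$k$k - M$j$k * M$k$j"
    and "adj3 M $ i $ j = M$i$k * M$k$j - M$i$j * M$k$k"
  unfolding adj3_def sym2_def trace_def
  using ne ne[symmetric]
  by (simp_all add: matrix_matrix_mult_def mat_nth univ)
     (simp_all add: field_simps power2_eq_square)

lemma trace_conj_transpose_mult_self: "trace (M\<^sup>\<dagger> ** M) = of_real ((norm M)\<^sup>2)"
  unfolding frob_inner_self[symmetric] frob_inner_def trace_def
  by (subst sum.swap) (simp add: matrix_matrix_mult_def mult.commute)

lemma sym2_conj_transpose_mult_self:
  fixes M :: "complex^'n^'n"
  assumes "CARD('n) = 3"
  shows "sym2 (M\<^sup>\<dagger> ** M) = of_real ((norm (adj3 M))\<^sup>2)"
proof -
  obtain i j k :: 'n where univ: "UNIV = {i, j, k}" and ne: "i \<noteq> j" "j \<noteq> k" "i \<noteq> k"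
    using assms card_3_iff[of "UNIV :: 'n set"] by metis
  have univ_perms: "UNIV = {i, k, j}" "UNIV = {j, i, k}" "UNIV = {j, k, i}" "UNIV = {k, i, j}"
    "UNIV = {k, j, i}"
    using univ by auto
  note entries = adj3_nth[OF univ ne] adj3_nth[OF univ_perms(1) ne(3) ne(2)[symmetric] ne(1)]
    adj3_nth[OF univ_perms(2) ne(1)[symmetric] ne(3,2)]
    adj3_nth[OF univ_perms(3) ne(2) ne(3)[symmetric] ne(1)[symmetric]]
    adj3_nth[OF univ_perms(4) ne(3)[symmetric] ne(1) ne(2)[symmetric]]
    adj3_nth[OF univ_perms(5) ne(2)[symmetric] ne(1)[symmetric] ne(3)[symmetric]]
  show ?thesis
    unfolding frob_inner_self[symmetric] frob_inner_def sym2_def trace_def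
    using ne ne[symmetric]
    by (simp add: entries matrix_matrix_mult_def univ)
       (simp add: field_simps power2_eq_square)
qed

lemma det_mat_minus_conj_transpose_mult_self:
  fixes M :: "complex^'n^'n"
  assumes "CARD('n) = 3"
  shows "det (mat (of_real t) - M\<^sup>\<dagger> ** M) =
    of_real (t ^ 3 - (norm M)\<^sup>2 * t\<^sup>2 + (norm (adj3 M))\<^sup>2 * t - (norm (det M))\<^sup>2)"
proof -
  have "det (M\<^sup>\<dagger> ** M) = of_real ((norm (det M))\<^sup>2)"
    by (simp add: det_mul det_conj_transpose complex_norm_square mult.commute del: of_real_power)
  then have "charpoly3 (M\<^sup>\<dagger> ** M) =
      [:- of_real ((norm (det M))\<^sup>2), of_real ((norm (adj3 M))\<^sup>2), - of_real ((norm M)\<^sup>2), 1:]"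
    by (simp add: charpoly3_def trace_conj_transpose_mult_self
        sym2_conj_transpose_mult_self[OF assms])
  then show ?thesis
    by (simp add: algebra_simps power2_eq_square power3_eq_cube flip: poly_charpoly3[OF assms])
qed

text \<open>With \<open>t = least_sv (z - A)\<^sup>2\<close>, which is a zero of both cubics, this is the difference of the
  characteristic polynomials of the Gram matrices of \<open>z - A\<close> and \<open>z - B\<close> at \<open>t\<close>, divided by \<open>t\<close>.\<close>

lemma norm_diff_mult_least_sv_square:
  fixes A B :: "complex^'n^'n"
  assumes card: "CARD('n) = 3" and charpoly: "charpoly3 A = charpoly3 B"
    and sv: "least_sv (mat z - A) = least_sv (mat z - B)" and inv: "invertible (mat z - A)"
  shows "((norm (mat z - A))\<^sup>2 - (norm (mat z - B))\<^sup>2) * (least_sv (mat z - A))\<^sup>2 =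
         (norm (adj3 (mat z - A)))\<^sup>2 - (norm (adj3 (mat z - B)))\<^sup>2"
proof -
  define t where "t = (least_sv (mat z - A))\<^sup>2"
  have "t \<noteq> 0"
    using inv by (simp add: t_def least_sv_eq_0_iff)
  have cubic: "t ^ 3 - (norm (mat z - M))\<^sup>2 * t\<^sup>2 + (norm (adj3 (mat z - M)))\<^sup>2 * t
      = (norm (det (mat z - M)))\<^sup>2"
    if "least_sv (mat z - M) = least_sv (mat z - A)" for M :: "complex^'n^'n"
    using det_least_sv[of "mat z - M"]
    unfolding det_mat_minus_conj_transpose_mult_self[OF card] that t_def[symmetric] of_real_eq_0_iff
    by simp
  have "det (mat z - A) = det (mat z - B)"
    using charpoly by (simp flip: poly_charpoly3[OF card])
  then have "t * (((norm (mat z - A))\<^sup>2 - (norm (mat z - B))\<^sup>2) * t) =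
      t * ((norm (adj3 (mat z - A)))\<^sup>2 - (norm (adj3 (mat z - B)))\<^sup>2)"
    using cubic[of A] cubic[of B] sv by (simp add: algebra_simps power2_eq_square)
  with \<open>t \<noteq> 0\<close> show ?thesis
    by (simp add: t_def)
qed

lemma polynomially_isometric_if_norm_poly_mat_eq:
  fixes A B :: "complex^'n^'n"
  assumes card: "CARD('n) = 3" and norm: "\<And>p. norm (poly_mat p A) = norm (poly_mat p B)"
  shows "polynomially_isometric A B"
  unfolding polynomially_isometric_def
proof
  fix p
  have trace: "trace (poly_mat q A) = trace (poly_mat q B)" for q
    using norm[of "q + [:_:]"] by (intro trace_eq_if_norm_add_mat_eq) simp
  have sym2: "sym2 (poly_mat p A) = sym2 (poly_mat p B)"
    unfolding sym2_def poly_mat_mult[symmetric] trace ..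
  define q where "q = p * p - smult (trace (poly_mat p A)) p + [:sym2 (poly_mat p A):]"
  have adj3: "adj3 (poly_mat p A) = poly_mat q A" "adj3 (poly_mat p B) = poly_mat q B"
    by (simp_all add: q_def adj3_def trace sym2)
  have det_trace: "3 * det M = trace (M ** adj3 M)" for M :: "complex^'n^'n"
    by (simp add: mult_adj3[OF card] trace_mat card)
  have "3 * det (poly_mat p A) = 3 * det (poly_mat p B)"
    unfolding det_trace adj3 poly_mat_mult[symmetric] trace ..
  then show "spec_norm (poly_mat p A) = spec_norm (poly_mat p B)"
    by (intro spec_norm_eq_if_det_eq)
       (simp add: det_mat_minus_conj_transpose_mult_self[OF card] norm adj3)
qed

section \<open>Recovering the Frobenius norms\<close>

lemma charpoly3_eqD:
  assumes "charpoly3 A = charpoly3 B"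
  shows "trace A = trace B" "trace (A ** A) = trace (B ** B)"
  using assms by (auto simp: charpoly3_def sym2_def)

lemma norm_diff_mult_least_sv_square_eq_quadratic:
  fixes A B :: "complex^'n^'n"
  defines "\<alpha> \<equiv> (norm A)\<^sup>2 - (norm B)\<^sup>2"
    and "\<beta> \<equiv> frob_inner (A ** A) A - frob_inner (B ** B) B"
    and "\<gamma> \<equiv> (norm (A ** A))\<^sup>2 - (norm (B ** B))\<^sup>2"
  assumes card: "CARD('n) = 3" and charpoly: "charpoly3 A = charpoly3 B"
    and sv: "MOST z. least_sv (mat z - A) = least_sv (mat z - B)"
  shows "MOST z. \<alpha> * (least_sv (mat z - A))\<^sup>2 =
    \<alpha> * (norm (z - trace A))\<^sup>2 + 2 * Re (cnj (z - trace A) * \<beta>) + \<gamma>"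
  using sv MOST_invertible_mat_minus[of A]
proof eventually_elim
  case (elim z)
  note diff = norm_poly_mat_quadratic_diff[OF charpoly3_eqD[OF charpoly]]
  have "(norm (mat z - A))\<^sup>2 - (norm (mat z - B))\<^sup>2 = \<alpha>"
    unfolding mat_minus_eq_poly_mat using diff[of z "- 1" 0] by (simp add: \<alpha>_def)
  moreover have "(norm (adj3 (mat z - A)))\<^sup>2 - (norm (adj3 (mat z - B)))\<^sup>2 =
      \<alpha> * (norm (z - trace A))\<^sup>2 + 2 * Re (cnj (z - trace A) * \<beta>) + \<gamma>"
    unfolding adj3_mat_minus[OF card] charpoly[symmetric] synthetic_div_charpoly3 diff
      \<alpha>_def \<beta>_def \<gamma>_def by simp
  ultimately show ?case
    using norm_diff_mult_least_sv_square[OF card charpoly elim] by (simp only:)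
qed

lemma ex_least_sv_eq_dist_if_norm_neq:
  fixes A B :: "complex^'n^'n"
  assumes card: "CARD('n) = 3" and charpoly: "charpoly3 A = charpoly3 B"
    and sv: "MOST z. least_sv (mat z - A) = least_sv (mat z - B)" and neq: "norm A \<noteq> norm B"
  shows "\<exists>l. MOST z. least_sv (mat z - A) = norm (z - l)"
proof (rule ex_least_sv_eq_dist_if_square_eq_quadratic)
  define \<alpha> \<beta> \<gamma> \<tau> where "\<alpha> = (norm A)\<^sup>2 - (norm B)\<^sup>2"
    and "\<beta> = frob_inner (A ** A) A - frob_inner (B ** B) B"
    and "\<gamma> = (norm (A ** A))\<^sup>2 - (norm (B ** B))\<^sup>2" and "\<tau> = trace A"
  have "\<alpha> \<noteq> 0"
    using neq by (simp add: \<alpha>_def)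
  have "MOST z. \<alpha> * (least_sv (mat z - A))\<^sup>2 =
      \<alpha> * (norm (z - \<tau>))\<^sup>2 + 2 * Re (cnj (z - \<tau>) * \<beta>) + \<gamma>"
    unfolding \<alpha>_def \<beta>_def \<gamma>_def \<tau>_def
    using card charpoly sv by (rule norm_diff_mult_least_sv_square_eq_quadratic)
  then show "MOST z. (least_sv (mat z - A))\<^sup>2 = (norm z)\<^sup>2 + 2 * Re (cnj z * (\<beta> / of_real \<alpha> - \<tau>))
      + ((norm \<tau>)\<^sup>2 + (\<gamma> - 2 * Re (cnj \<tau> * \<beta>)) / \<alpha>)"
  proof (rule eventually_mono)
    fix z
    assume "\<alpha> * (least_sv (mat z - A))\<^sup>2 = \<alpha> * (norm (z - \<tau>))\<^sup>2 + 2 * Re (cnj (z - \<tau>) * \<beta>) + \<gamma>"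
    then have "(least_sv (mat z - A))\<^sup>2 = (norm (z - \<tau>))\<^sup>2 + (2 * Re (cnj (z - \<tau>) * \<beta>) + \<gamma>) / \<alpha>"
      using \<open>\<alpha> \<noteq> 0\<close> by (simp add: field_simps)
    also have "\<dots> = (norm z)\<^sup>2 + 2 * Re (cnj z * (\<beta> / of_real \<alpha> - \<tau>))
      + ((norm \<tau>)\<^sup>2 + (\<gamma> - 2 * Re (cnj \<tau> * \<beta>)) / \<alpha>)"
      using \<open>\<alpha> \<noteq> 0\<close> by (simp add: cmod_power2 Re_divide_of_real Im_divide_of_real)
        (simp add: field_simps power2_eq_square)
    finally show "(least_sv (mat z - A))\<^sup>2 = (norm z)\<^sup>2 + 2 * Re (cnj z * (\<beta> / of_real \<alpha> - \<tau>))
      + ((norm \<tau>)\<^sup>2 + (\<gamma> - 2 * Re (cnj \<tau> * \<beta>)) / \<alpha>)" .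
  qed
qed

lemma norm_eq_if_MOST_least_sv_eq:
  fixes A B :: "complex^'n^'n"
  assumes card: "CARD('n) = 3" and charpoly: "charpoly3 A = charpoly3 B"
    and sv: "MOST z. least_sv (mat z - A) = least_sv (mat z - B)"
    and not_scalar: "\<And>l. A \<noteq> mat l"
  shows "norm A = norm B"
  using ex_least_sv_eq_dist_if_norm_neq[OF card charpoly sv] not_scalar
    eq_mat_if_MOST_least_sv_eq_dist by blast

lemma frob_inner_square_eq_if_norm_eq:
  fixes A B :: "complex^'n^'n"
  assumes card: "CARD('n) = 3" and charpoly: "charpoly3 A = charpoly3 B"
    and sv: "MOST z. least_sv (mat z - A) = least_sv (mat z - B)" and norm: "norm A = norm B"
  shows "frob_inner (A ** A) A = frob_inner (B ** B) B" and "norm (A ** A) = norm (B ** B)"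
proof -
  define \<beta> \<gamma> where "\<beta> = frob_inner (A ** A) A - frob_inner (B ** B) B"
    and "\<gamma> = (norm (A ** A))\<^sup>2 - (norm (B ** B))\<^sup>2"
  let ?f = "\<lambda>z. 2 * Re (cnj (z - trace A) * \<beta>) + \<gamma>"
  have "MOST z. ?f z = 0"
    using norm_diff_mult_least_sv_square_eq_quadratic[OF card charpoly sv]
    by (simp add: norm \<beta>_def \<gamma>_def)
  then have "?f z = 0" for z
    by (intro eq_if_MOST_eq[of ?f "\<lambda>_. 0"] continuous_intros)
  from this[of "_ + trace A"] have affine: "2 * Re (cnj w * \<beta>) + \<gamma> = 0" for w
    by simp
  from affine[of 0] have "\<gamma> = 0"
    by simp
  moreover have "\<beta> = 0"
  proof (rule complex_eq_0_if_Re_bounded_above)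
    show "Re (cnj w * \<beta>) \<le> 0" for w
      using affine[of w] \<open>\<gamma> = 0\<close> by linarith
  qed
  ultimately show "frob_inner (A ** A) A = frob_inner (B ** B) B" "norm (A ** A) = norm (B ** B)"
    by (simp_all add: \<beta>_def \<gamma>_def)
qed

lemma degree_le_2_cases:
  assumes "degree p \<le> 2"
  obtains a b c where "p = [:a, b, c:]"
proof
  have "coeff p n = 0" if "n > 2" for n
    using assms that by (intro coeff_eq_0) simp
  then show "p = [:coeff p 0, coeff p 1, coeff p 2:]"
    by (intro poly_eqI) (simp add: coeff_pCons numeral_2_eq_2 split: nat.split)
qed

lemma norm_poly_mat_eq_if_frobenius_eq:
  fixes A B :: "complex^'n^'n"
  assumes card: "CARD('n) = 3" and charpoly: "charpoly3 A = charpoly3 B"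
    and frobenius: "norm A = norm B" "frob_inner (A ** A) A = frob_inner (B ** B) B"
      "norm (A ** A) = norm (B ** B)"
  shows "norm (poly_mat p A) = norm (poly_mat p B)"
proof -
  define r where "r = p mod charpoly3 A"
  have r: "poly_mat r A = poly_mat p A" "poly_mat r B = poly_mat p B"
    unfolding r_def using cayley_hamilton_three[OF card] charpoly by (metis poly_mat_mod)+
  have "degree r \<le> 2"
    using degree_mod_less[of "charpoly3 A" p] by (auto simp: r_def charpoly3_def)
  then obtain a b c where "r = [:a, b, c:]"
    by (rule degree_le_2_cases)
  then have "(norm (poly_mat r A))\<^sup>2 = (norm (poly_mat r B))\<^sup>2"
    using norm_poly_mat_quadratic_diff[OF charpoly3_eqD[OF charpoly], of a b c] frobenius by simp
  then show ?thesis
    by (simp add: r)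
qed

lemma polynomially_isometric_if_CARD_3:
  fixes A B :: "complex^'n^'n"
  assumes card: "CARD('n) = 3" and sv: "MOST z. least_sv (mat z - A) = least_sv (mat z - B)"
  shows "polynomially_isometric A B"
proof (cases "\<exists>q. q \<noteq> 0 \<and> degree q \<le> 2 \<and> poly_mat q A = 0")
  case True
  then show ?thesis
    using polynomially_isometric_if_quadratic_annihilator[OF sv] by blast
next
  case False
  then have no_annihilator: "q = 0" if "degree q \<le> 2" "poly_mat q A = 0" for q
    using that by blast
  have "poly_mat (charpoly3 B) A = 0"
    using sv cayley_hamilton_three[OF card] by (rule poly_mat_eq_0_if_MOST_least_sv_eq)
  then have "poly_mat (charpoly3 A - charpoly3 B) A = 0"
    by (simp add: cayley_hamilton_three[OF card])
  moreover have "degree (charpoly3 A - charpoly3 B) \<le> 2"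
    by (simp add: charpoly3_def)
  ultimately have charpoly: "charpoly3 A = charpoly3 B"
    using no_annihilator[of "charpoly3 A - charpoly3 B"] by simp
  have "A \<noteq> mat l" for l
    using no_annihilator[of "[:- l, 1:]"] by (auto simp: poly_mat_linear simp flip: mat_add)
  then have norm: "norm A = norm B"
    by (rule norm_eq_if_MOST_least_sv_eq[OF card charpoly sv])
  note frobenius = norm frob_inner_square_eq_if_norm_eq[OF card charpoly sv norm]
  show ?thesis
    using card norm_poly_mat_eq_if_frobenius_eq[OF card charpoly frobenius]
    by (rule polynomially_isometric_if_norm_poly_mat_eq)
qed

lemma polynomially_isometric_if_CARD_2:
  fixes A B :: "complex^'n^'n"
  assumes card: "CARD('n) = 2" and sv: "MOST z. least_sv (mat z - A) = least_sv (mat z - B)"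
  shows "polynomially_isometric A B"
  using sv _ _ cayley_hamilton_two[OF card]
  by (rule polynomially_isometric_if_quadratic_annihilator) simp_all

theorem theorem1:
  fixes A B :: "complex^'n^'n"
  assumes "CARD('n) = 2 \<or> CARD('n) = 3"
  shows "(\<forall>z. resolvent_norm A z = resolvent_norm B z) \<longleftrightarrow>
         (\<forall>p. spec_norm (poly_mat p A) = spec_norm (poly_mat p B))"
  unfolding resolvent_norm_eq_iff_least_sv_eq polynomially_isometric_def[symmetric]
proof
  assume "\<forall>z. least_sv (mat z - A) = least_sv (mat z - B)"
  then have "MOST z. least_sv (mat z - A) = least_sv (mat z - B)"
    by simp
  with assms show "polynomially_isometric A B"
    using polynomially_isometric_if_CARD_2 polynomially_isometric_if_CARD_3 by blast
next
  assume "polynomially_isometric A B"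
  then show "\<forall>z. least_sv (mat z - A) = least_sv (mat z - B)"
    by (blast intro: least_sv_eq_if_polynomially_isometric)
qed

end
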